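(* Let $(A,V)$ and $(B,W)$ be permutation groups. Then $A\wr B\in GR$ if and only if $A\in GR\cup\{I_2\}$ and one of the following holds: (1) $B\in GR\cup\{I_2\}$; or (2) $B\in DGR\setminus (GR\cup\{I_2\})$ and $A$ is intransitive.
   Context: Permutation groups are considered up to permutation isomorphism and act on sets with more than one element. A colored graph is a pair $(V,E)$ with $E$ a function from the unordered pairs of distinct vertices to a set of colors; a colored directed graph is defined likewise with ordered pairs of distinct vertices; automorphisms are color-preserving permutations of the vertex set. $GR$ is the class of permutation groups that are (permutation isomorphic to) the automorphism group of some colored graph, and $DGR$ the class of those that are the automorphism group of some colored directed graph. $I_2$ denotes the trivial (identity) group acting on a $2$-element set. The (imprimitive) wreath product $A\wr B$ is the permutation group on $V\times W$ consisting of all permutations $\gamma$ for which there are $\alpha_w\in A$ ($w\in W$) and $\beta\in B$ with $(v,w)\gamma=(v\alpha_w,w\beta)$ for all $(v,w)\in V\times W$. *)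

theory Defs
  imports "HOL-Algebra.Group_Action"
begin

text \<open>
  A permutation group is a pair \<open>(A, V)\<close>, where \<open>A\<close> is a subgroup of the library group of all
  permutations of \<open>V\<close>. The elements of \<^term>\<open>Bij V\<close> are bijections that take the value
  \<^term>\<open>undefined\<close> outside \<open>V\<close>, so that two permutations are equal iff they agree on \<open>V\<close>.
  The sets may be finite or infinite.
\<close>

type_synonym 'v perm_grp = "('v \<Rightarrow> 'v) set \<times> 'v set"

fun perm_group :: "'v perm_grp \<Rightarrow> bool" where
  "perm_group (A, V) \<longleftrightarrow> subgroup A (BijGroup V) \<and> (\<exists>x\<in>V. \<exists>y\<in>V. x \<noteq> y)"

fun grp_of :: "'v perm_grp \<Rightarrow> ('v \<Rightarrow> 'v) monoid" where
  "grp_of (A, V) = (BijGroup V)\<lparr>carrier := A\<rparr>"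

fun perm_iso :: "'v perm_grp \<Rightarrow> 'w perm_grp \<Rightarrow> bool" where
  "perm_iso (A, V) (B, W) \<longleftrightarrow>
     (\<exists>\<phi> \<psi>. bij_betw \<phi> V W \<and> \<psi> \<in> iso (grp_of (A, V)) (grp_of (B, W)) \<and>
            (\<forall>a\<in>A. \<forall>v\<in>V. \<phi> (a v) = \<psi> a (\<phi> v)))"

fun intransitive :: "'v perm_grp \<Rightarrow> bool" where
  "intransitive (A, V) \<longleftrightarrow> \<not> transitive_action (grp_of (A, V)) V (\<lambda>a. a)"

lemma intransitive_iff:
  assumes "perm_group (A, V)"
  shows "intransitive (A, V) \<longleftrightarrow> (\<exists>x\<in>V. \<exists>y\<in>V. \<forall>a\<in>A. a x \<noteq> y)"
proof -
  interpret group "BijGroup V" by (rule group_BijGroup)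
  have A: "subgroup A (BijGroup V)" using assms by simp
  have "group_hom ((BijGroup V)\<lparr>carrier := A\<rparr>) (BijGroup V) (\<lambda>a. a)"
    using subgroup.subset[OF A] subgroup_imp_group[OF A] group_BijGroup
    by (auto simp: group_hom_def group_hom_axioms_def hom_def)
  then show ?thesis
    by (auto simp: transitive_action_def transitive_action_axioms_def group_action_def)
qed

text \<open>
  A colored graph on \<open>V\<close> is given by \<open>E :: 'v set \<Rightarrow> 'c\<close>, a colored directed graph by
  \<open>E :: 'v \<times> 'v \<Rightarrow> 'c\<close>; only the values of \<open>E\<close> on unordered (ordered) pairs of distinct elements
  of \<open>V\<close> are ever used.
\<close>

definition aut_graph :: "'v set \<Rightarrow> ('v set \<Rightarrow> 'c) \<Rightarrow> ('v \<Rightarrow> 'v) set" where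
  "aut_graph V E = {g \<in> Bij V. \<forall>x\<in>V. \<forall>y\<in>V. x \<noteq> y \<longrightarrow> E {g x, g y} = E {x, y}}"

definition aut_digraph :: "'v set \<Rightarrow> ('v \<times> 'v \<Rightarrow> 'c) \<Rightarrow> ('v \<Rightarrow> 'v) set" where
  "aut_digraph V E = {g \<in> Bij V. \<forall>x\<in>V. \<forall>y\<in>V. x \<noteq> y \<longrightarrow> E (g x, g y) = E (x, y)}"

text \<open>
  HOL cannot quantify over the type of vertices and the type of colors inside a definition.
  Vertices are therefore taken from the type on which the group acts, and colors from the type
  of unordered (ordered) pairs of vertices. By \<open>GR_I\<close> and \<open>DGR_I\<close> below this is no
  restriction.
\<close>

definition GR :: "'v perm_grp set" where
  "GR = {P. perm_group P \<and> (\<exists>(X :: 'v set) (E :: 'v set \<Rightarrow> 'v set). perm_iso P (aut_graph X E, X))}"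

definition DGR :: "'v perm_grp set" where
  "DGR = {P. perm_group P \<and>
             (\<exists>(X :: 'v set) (E :: 'v \<times> 'v \<Rightarrow> 'v \<times> 'v). perm_iso P (aut_digraph X E, X))}"

text \<open>All permutation groups isomorphic to \<open>I\<^sub>2\<close>.\<close>

definition I2 :: "'v perm_grp set" where
  "I2 = {(A, V). card V = 2 \<and> A = {\<one>\<^bsub>BijGroup V\<^esub>}}"

fun wreath :: "'v perm_grp \<Rightarrow> 'w perm_grp \<Rightarrow> ('v \<times> 'w) perm_grp" where
  "wreath (A, V) (B, W) =
     ({\<gamma> \<in> Bij (V \<times> W).
         \<exists>\<alpha>. (\<forall>w\<in>W. \<alpha> w \<in> A) \<and> (\<exists>\<beta>\<in>B. \<forall>v\<in>V. \<forall>w\<in>W. \<gamma> (v, w) = (\<alpha> w v, \<beta> w))},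
      V \<times> W)"

lemma perm_iso_refl: "perm_iso (A, V) (A, V)"
proof -
  have "id \<in> iso (grp_of (A, V)) (grp_of (A, V))"
    by (auto simp: iso_def hom_def)
  then show ?thesis
    by (auto intro!: exI[of _ "id :: _ \<Rightarrow> _"] simp: bij_betw_def)
qed

lemma perm_iso_mem:
  assumes A: "subgroup A (BijGroup V)" and B: "B \<subseteq> Bij X"
    and iso: "perm_iso (A, V) (B, X)"
  obtains \<phi> where "bij_betw \<phi> V X"
    and "\<And>g. g \<in> Bij V \<Longrightarrow> g \<in> A \<longleftrightarrow> (\<exists>b\<in>B. \<forall>v\<in>V. \<phi> (g v) = b (\<phi> v))"
proof -
  obtain \<phi> \<psi> where \<phi>: "bij_betw \<phi> V X" and \<psi>: "\<psi> \<in> iso (grp_of (A, V)) (grp_of (B, X))"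
    and eq: "\<And>a v. a \<in> A \<Longrightarrow> v \<in> V \<Longrightarrow> \<phi> (a v) = \<psi> a (\<phi> v)"
    using iso by auto
  have bij: "bij_betw \<psi> A B" using \<psi> by (auto simp: iso_def)
  have AV: "A \<subseteq> Bij V" using subgroup.subset[OF A] by (simp add: BijGroup_def)
  have "g \<in> A \<longleftrightarrow> (\<exists>b\<in>B. \<forall>v\<in>V. \<phi> (g v) = b (\<phi> v))" if g: "g \<in> Bij V" for g
  proof
    assume "g \<in> A" then show "\<exists>b\<in>B. \<forall>v\<in>V. \<phi> (g v) = b (\<phi> v)"
      using bij eq by (auto simp: bij_betw_def)
  next
    assume "\<exists>b\<in>B. \<forall>v\<in>V. \<phi> (g v) = b (\<phi> v)"
    then obtain b where b: "b \<in> B" "\<And>v. v \<in> V \<Longrightarrow> \<phi> (g v) = b (\<phi> v)" by auto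
    obtain a where a: "a \<in> A" "b = \<psi> a" using b bij by (auto simp: bij_betw_def)
    have "g = a"
    proof (rule extensionalityI)
      show "g \<in> extensional V" "a \<in> extensional V" using g a AV by (auto simp: Bij_def)
    next
      fix v assume v: "v \<in> V"
      have "g v \<in> V" "a v \<in> V" using v g a AV by (auto simp: Bij_def bij_betw_def)
      moreover have "\<phi> (g v) = \<phi> (a v)" using b(2) a eq v by auto
      ultimately show "g v = a v" using \<phi> by (auto simp: bij_betw_def inj_on_def)
    qed
    then show "g \<in> A" using a by simp
  qed
  with \<phi> show ?thesis using that by blast
qed

lemma conj_Bij:
  assumes \<phi>: "bij_betw \<phi> V X" and g: "g \<in> Bij V"
  obtains b where "b \<in> Bij X" "\<And>v. v \<in> V \<Longrightarrow> b (\<phi> v) = \<phi> (g v)"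
proof
  let ?b = "restrict (\<phi> \<circ> g \<circ> inv_into V \<phi>) X"
  have "bij_betw (\<phi> \<circ> g \<circ> inv_into V \<phi>) X X"
    using \<phi> g bij_betw_inv_into[OF \<phi>] by (auto simp: Bij_def intro: bij_betw_trans)
  then have "bij_betw ?b X X"
    by (rule bij_betw_cong[THEN iffD1, rotated]) auto
  then show "?b \<in> Bij X" by (simp add: Bij_def)
  fix v assume "v \<in> V"
  then show "?b (\<phi> v) = \<phi> (g v)"
    using \<phi> by (auto simp: bij_betw_def)
qed

lemma GR_I:
  fixes X :: "'w set" and E :: "'w set \<Rightarrow> 'c"
  assumes P: "perm_group (A, V)" and iso: "perm_iso (A, V) (aut_graph X E, X)"
  shows "(A, V) \<in> GR"
proof -
  have sub: "subgroup A (BijGroup V)" using P by simp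
  obtain \<phi> where \<phi>: "bij_betw \<phi> V X"
    and mem: "\<And>g. g \<in> Bij V \<Longrightarrow> g \<in> A \<longleftrightarrow> (\<exists>b\<in>aut_graph X E. \<forall>v\<in>V. \<phi> (g v) = b (\<phi> v))"
    by (rule perm_iso_mem[OF sub _ iso]) (auto simp: aut_graph_def)
  define E' where "E' e = (SOME e'. E (\<phi> ` e') = E (\<phi> ` e))" for e
  have E': "E' e = E' e' \<longleftrightarrow> E (\<phi> ` e) = E (\<phi> ` e')" for e e'
  proof
    have *: "E (\<phi> ` E' e) = E (\<phi> ` e)" for e
      unfolding E'_def by (rule someI) (rule refl)
    assume "E' e = E' e'" then show "E (\<phi> ` e) = E (\<phi> ` e')" using *[of e] *[of e'] by simp
  qed (simp add: E'_def)
  have AV: "A \<subseteq> Bij V" using subgroup.subset[OF sub] by (simp add: BijGroup_def)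
  have "g \<in> A \<longleftrightarrow> g \<in> aut_graph V E'" if g: "g \<in> Bij V" for g
  proof
    assume "g \<in> A"
    then obtain b where b: "b \<in> aut_graph X E" "\<And>v. v \<in> V \<Longrightarrow> \<phi> (g v) = b (\<phi> v)"
      using mem[OF g] by auto
    show "g \<in> aut_graph V E'"
      unfolding aut_graph_def
    proof (intro CollectI conjI ballI impI)
      fix x y assume xy: "x \<in> V" "y \<in> V" "x \<noteq> y"
      then have "\<phi> x \<in> X" "\<phi> y \<in> X" "\<phi> x \<noteq> \<phi> y"
        using \<phi> by (auto simp: bij_betw_def inj_on_def)
      then have "E {b (\<phi> x), b (\<phi> y)} = E {\<phi> x, \<phi> y}"
        using b(1) by (simp add: aut_graph_def)
      then show "E' {g x, g y} = E' {x, y}"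
        using b(2) xy by (simp add: E')
    qed (rule g)
  next
    assume gA: "g \<in> aut_graph V E'"
    obtain b where b: "b \<in> Bij X" "\<And>v. v \<in> V \<Longrightarrow> b (\<phi> v) = \<phi> (g v)"
      using conj_Bij[OF \<phi> g] by blast
    have X: "X = \<phi> ` V" using \<phi> by (auto simp: bij_betw_def)
    have "b \<in> aut_graph X E"
      using gA b unfolding X by (auto simp: aut_graph_def E')
    then show "g \<in> A" using mem[OF g] b(2)[symmetric] by blast
  qed
  then have "A = aut_graph V E'" using AV by (auto simp: aut_graph_def)
  then have "perm_iso (A, V) (aut_graph V E', V)" using perm_iso_refl by metis
  then show ?thesis using P unfolding GR_def by blast
qed

lemma DGR_I:
  fixes X :: "'w set" and E :: "'w \<times> 'w \<Rightarrow> 'c"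
  assumes P: "perm_group (A, V)" and iso: "perm_iso (A, V) (aut_digraph X E, X)"
  shows "(A, V) \<in> DGR"
proof -
  have sub: "subgroup A (BijGroup V)" using P by simp
  obtain \<phi> where \<phi>: "bij_betw \<phi> V X"
    and mem: "\<And>g. g \<in> Bij V \<Longrightarrow> g \<in> A \<longleftrightarrow> (\<exists>b\<in>aut_digraph X E. \<forall>v\<in>V. \<phi> (g v) = b (\<phi> v))"
    by (rule perm_iso_mem[OF sub _ iso]) (auto simp: aut_digraph_def)
  define E' where "E' e = (SOME e'. E (map_prod \<phi> \<phi> e') = E (map_prod \<phi> \<phi> e))" for e
  have E': "E' e = E' e' \<longleftrightarrow> E (map_prod \<phi> \<phi> e) = E (map_prod \<phi> \<phi> e')" for e e'
  proof
    have *: "E (map_prod \<phi> \<phi> (E' e)) = E (map_prod \<phi> \<phi> e)" for e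
      unfolding E'_def by (rule someI) (rule refl)
    assume "E' e = E' e'"
    then show "E (map_prod \<phi> \<phi> e) = E (map_prod \<phi> \<phi> e')" using *[of e] *[of e'] by simp
  qed (simp add: E'_def)
  have AV: "A \<subseteq> Bij V" using subgroup.subset[OF sub] by (simp add: BijGroup_def)
  have "g \<in> A \<longleftrightarrow> g \<in> aut_digraph V E'" if g: "g \<in> Bij V" for g
  proof
    assume "g \<in> A"
    then obtain b where b: "b \<in> aut_digraph X E" "\<And>v. v \<in> V \<Longrightarrow> \<phi> (g v) = b (\<phi> v)"
      using mem[OF g] by auto
    show "g \<in> aut_digraph V E'"
      unfolding aut_digraph_def
    proof (intro CollectI conjI ballI impI)
      fix x y assume xy: "x \<in> V" "y \<in> V" "x \<noteq> y"
      then have "\<phi> x \<in> X" "\<phi> y \<in> X" "\<phi> x \<noteq> \<phi> y"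
        using \<phi> by (auto simp: bij_betw_def inj_on_def)
      then have "E (b (\<phi> x), b (\<phi> y)) = E (\<phi> x, \<phi> y)"
        using b(1) by (simp add: aut_digraph_def)
      then show "E' (g x, g y) = E' (x, y)"
        using b(2) xy by (simp add: E')
    qed (rule g)
  next
    assume gA: "g \<in> aut_digraph V E'"
    obtain b where b: "b \<in> Bij X" "\<And>v. v \<in> V \<Longrightarrow> b (\<phi> v) = \<phi> (g v)"
      using conj_Bij[OF \<phi> g] by blast
    have X: "X = \<phi> ` V" using \<phi> by (auto simp: bij_betw_def)
    have "b \<in> aut_digraph X E"
      using gA b unfolding X by (auto simp: aut_digraph_def E')
    then show "g \<in> A" using mem[OF g] b(2)[symmetric] by blast
  qed
  then have "A = aut_digraph V E'" using AV by (auto simp: aut_digraph_def)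
  then have "perm_iso (A, V) (aut_digraph V E', V)" using perm_iso_refl by metis
  then show ?thesis using P unfolding DGR_def by blast
qed

end

theory Submission
  imports Defs
begin

text \<open>
  The finest coloring preserved by a group colors every edge (arc) by its orbit. Hence a group is in
  \<open>GR\<close> (\<open>DGR\<close>) iff it contains every permutation that maps each unordered (ordered) pair of distinct
  points into its orbit. A permutation preserving the edge orbits of the wreath product has the form
  \<open>(v, w) \<mapsto> (\<alpha>\<^sub>w v, \<beta> w)\<close>; edges inside a block constrain \<open>\<alpha>\<^sub>w\<close> and the vertex orbits of \<open>\<beta>\<close>, while edges
  between blocks constrain \<open>\<beta>\<close> and the vertex orbits of the \<open>\<alpha>\<^sub>w\<close>. If \<open>A\<close> is intransitive, an edge between
  blocks can be given an orientation by choosing endpoints in different \<open>A\<close>-orbits, so \<open>\<beta>\<close> preserves even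
  the arc orbits of \<open>B\<close>; if \<open>A\<close> is transitive, the two ends can always be exchanged. Finally, \<open>I\<^sub>2\<close> is the
  only group for which preserving edge orbits does not imply preserving vertex orbits, and both vertex
  conditions above are automatic in the wreath product.
\<close>

section \<open>Closure properties of permutation groups and elementary facts about
  \<open>Bij\<close>\<close>

lemma perm_group_Bij: "perm_group (A, V) \<Longrightarrow> a \<in> A \<Longrightarrow> a \<in> Bij V"
  using subgroup.subset[of A "BijGroup V"] by (auto simp: BijGroup_def)

lemma perm_group_id: "perm_group (A, V) \<Longrightarrow> (\<lambda>x\<in>V. x) \<in> A"
  using subgroup.one_closed[of A "BijGroup V"] by (auto simp: BijGroup_def)

lemma perm_group_compose:
  assumes "perm_group (A, V)" "a \<in> A" "b \<in> A"
  shows "compose V a b \<in> A"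
  using assms subgroup.m_closed[of A "BijGroup V" a b] perm_group_Bij[OF assms(1)]
  by (auto simp: BijGroup_def)

lemma perm_group_inv:
  assumes "perm_group (A, V)" "a \<in> A"
  shows "(\<lambda>x\<in>V. inv_into V a x) \<in> A"
  using assms subgroup.m_inv_closed[of A "BijGroup V" a] perm_group_Bij[OF assms]
  by (simp add: inv_BijGroup)

lemma Bij_mem: "f \<in> Bij S \<Longrightarrow> x \<in> S \<Longrightarrow> f x \<in> S"
  by (auto simp: Bij_def bij_betw_def)

lemma Bij_eq_iff: "f \<in> Bij S \<Longrightarrow> x \<in> S \<Longrightarrow> y \<in> S \<Longrightarrow> f x = f y \<longleftrightarrow> x = y"
  by (auto simp: Bij_def bij_betw_def inj_on_def)

lemma Bij_surj: "f \<in> Bij S \<Longrightarrow> y \<in> S \<Longrightarrow> \<exists>x\<in>S. y = f x"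
  by (auto simp: Bij_def bij_betw_def)

lemma BijI:
  assumes "f \<in> extensional S" "\<And>x. x \<in> S \<Longrightarrow> f x \<in> S" "inj_on f S"
    and "\<And>y. y \<in> S \<Longrightarrow> \<exists>x\<in>S. y = f x"
  shows "f \<in> Bij S"
  using assms by (auto simp: Bij_def bij_betw_def)

lemma Bij_eqI: "f \<in> Bij S \<Longrightarrow> g \<in> Bij S \<Longrightarrow> (\<And>x. x \<in> S \<Longrightarrow> f x = g x) \<Longrightarrow> f = g"
  by (rule extensionalityI[of _ S]) (auto simp: Bij_def)

section \<open>Membership in \<open>GR\<close> and \<open>DGR\<close> in terms of edge and arc
  orbits\<close>

text \<open>The element \<open>a\<close> may depend on the edge, and it may match the two ends
  crosswise. For a permutation group \<open>A\<close>, the members of \<open>Bij V\<close> with this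
  property form the automorphism group of the coloring of edges by \<open>A\<close>-orbits.\<close>

definition preserves_edge_orbits :: "('v \<Rightarrow> 'v) set \<Rightarrow> 'v set \<Rightarrow> ('v \<Rightarrow> 'v) \<Rightarrow> bool" where
  "preserves_edge_orbits A V g \<longleftrightarrow> (\<forall>x\<in>V. \<forall>y\<in>V. x \<noteq> y \<longrightarrow> (\<exists>a\<in>A. {g x, g y} = {a x, a y}))"

text \<open>For a permutation group \<open>A\<close>, the members of \<open>Bij V\<close> with this
  property form Wielandt's 2-closure of \<open>A\<close>.\<close>

definition preserves_arc_orbits :: "('v \<Rightarrow> 'v) set \<Rightarrow> 'v set \<Rightarrow> ('v \<Rightarrow> 'v) \<Rightarrow> bool" where
  "preserves_arc_orbits A V g \<longleftrightarrow> (\<forall>x\<in>V. \<forall>y\<in>V. x \<noteq> y \<longrightarrow> (\<exists>a\<in>A. g x = a x \<and> g y = a y))"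

text \<open>A coloring with automorphism group \<open>A\<close> is constant on edge orbits, so
  whatever preserves the orbits preserves the coloring; conversely, the coloring by orbits realizes
  \<open>A\<close>. Later arguments about \<open>GR\<close> thus need no colorings or
  isomorphisms.\<close>

lemma GR_iff:
  assumes P: "perm_group (A, V)"
  shows "(A, V) \<in> GR \<longleftrightarrow> (\<forall>g\<in>Bij V. preserves_edge_orbits A V g \<longrightarrow> g \<in> A)"
proof
  assume "(A, V) \<in> GR"
  then obtain X :: "'a set" and E :: "'a set \<Rightarrow> 'a set"
    where iso: "perm_iso (A, V) (aut_graph X E, X)" unfolding GR_def by blast
  have sub: "subgroup A (BijGroup V)" using P by simp
  obtain \<phi> where \<phi>: "bij_betw \<phi> V X"
    and mem: "\<And>g. g \<in> Bij V \<Longrightarrow> g \<in> A \<longleftrightarrow> (\<exists>b\<in>aut_graph X E. \<forall>v\<in>V. \<phi> (g v) = b (\<phi> v))"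
    by (rule perm_iso_mem[OF sub _ iso]) (auto simp: aut_graph_def)
  have inj: "\<phi> x \<noteq> \<phi> y" if "x \<in> V" "y \<in> V" "x \<noteq> y" for x y
    using that \<phi> by (auto simp: bij_betw_def inj_on_def)
  have X: "X = \<phi> ` V" using \<phi> by (simp add: bij_betw_def)
  show "\<forall>g\<in>Bij V. preserves_edge_orbits A V g \<longrightarrow> g \<in> A"
  proof (intro ballI impI)
    fix g assume g: "g \<in> Bij V" and orb: "preserves_edge_orbits A V g"
    \<comment> \<open>The coloring lives on \<open>X\<close>, so \<open>g\<close> is conjugated
      along \<phi> to a permutation \<open>b\<close> of \<open>X\<close>.\<close>
    obtain b where b: "b \<in> Bij X" "\<And>v. v \<in> V \<Longrightarrow> b (\<phi> v) = \<phi> (g v)"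
      using conj_Bij[OF \<phi> g] by blast
    have "E (\<phi> ` {g x, g y}) = E {\<phi> x, \<phi> y}" if xy: "x \<in> V" "y \<in> V" "x \<noteq> y" for x y
    proof -
      obtain a where a: "a \<in> A" "{g x, g y} = {a x, a y}"
        using orb xy unfolding preserves_edge_orbits_def by blast
      obtain c where c: "c \<in> aut_graph X E" "\<forall>v\<in>V. \<phi> (a v) = c (\<phi> v)"
        using a(1) mem[OF perm_group_Bij[OF P a(1)]] by simp blast
      show ?thesis using c a(2) xy inj[OF xy] by (auto simp: aut_graph_def X)
    qed
    then have "b \<in> aut_graph X E" using b by (auto simp: aut_graph_def X)
    then show "g \<in> A" using mem[OF g] b(2)[symmetric] by blast
  qed
next
  assume closed: "\<forall>g\<in>Bij V. preserves_edge_orbits A V g \<longrightarrow> g \<in> A"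
  \<comment> \<open>The color of \<open>e\<close> is its orbit. This color is a set of edges, which
    \<open>GR_I\<close> permits because it accepts any type of colors.\<close>
  define E where "E e = (\<lambda>a. a ` e) ` A" for e
  have "A = aut_graph V E"
  proof (intro equalityI subsetI)
    fix a assume a: "a \<in> A"
    have aB: "a \<in> Bij V" by (rule perm_group_Bij[OF P a])
    have "E {a x, a y} = E {x, y}" if xy: "x \<in> V" "y \<in> V" for x y
    proof (intro equalityI subsetI)
      fix e assume "e \<in> E {a x, a y}"
      then obtain b where b: "b \<in> A" "e = {b (a x), b (a y)}" by (auto simp: E_def)
      then have "e = compose V b a ` {x, y}" using xy by (simp add: compose_def)
      then show "e \<in> E {x, y}" unfolding E_def using perm_group_compose[OF P b(1) a] by blast
    next
      fix e assume "e \<in> E {x, y}"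
      then obtain b where b: "b \<in> A" "e = {b x, b y}" by (auto simp: E_def)
      \<comment> \<open>The inverse of \<open>a\<close> followed by \<open>b\<close> maps
        \<open>{a x, a y}\<close> to \<open>{b x, b y}\<close>.\<close>
      let ?c = "compose V b (\<lambda>x\<in>V. inv_into V a x)"
      have "inv_into V a (a z) = z" if "z \<in> V" for z
        using that aB by (auto simp: Bij_def bij_betw_def)
      then have "e = ?c ` {a x, a y}" using xy b Bij_mem[OF aB] by (simp add: compose_def)
      then show "e \<in> E {a x, a y}"
        unfolding E_def using perm_group_compose[OF P b(1) perm_group_inv[OF P a]] by blast
    qed
    then show "a \<in> aut_graph V E" using aB by (auto simp: aut_graph_def)
  next
    fix g assume g: "g \<in> aut_graph V E"
    have "preserves_edge_orbits A V g"
      unfolding preserves_edge_orbits_def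
    proof (intro ballI impI)
      fix x y assume xy: "x \<in> V" "y \<in> V" "x \<noteq> y"
      have gV: "g x \<in> V" "g y \<in> V" using g xy by (auto simp: aut_graph_def Bij_mem)
      have "{g x, g y} = (\<lambda>x\<in>V. x) ` {g x, g y}" using gV by simp
      then have "{g x, g y} \<in> E {g x, g y}" using perm_group_id[OF P] unfolding E_def by blast
      then have "{g x, g y} \<in> E {x, y}" using g xy by (simp add: aut_graph_def)
      then show "\<exists>a\<in>A. {g x, g y} = {a x, a y}" by (auto simp: E_def)
    qed
    then show "g \<in> A" using closed g by (simp add: aut_graph_def)
  qed
  then have "perm_iso (A, V) (aut_graph V E, V)"
    by (rule subst[where P = "\<lambda>X. perm_iso (A, V) (X, V)"]) (rule perm_iso_refl)
  then show "(A, V) \<in> GR" by (rule GR_I[OF P])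
qed

text \<open>Here the coloring of arcs by their orbits realizes \<open>A\<close>, as in the second
  half of \<open>GR_iff\<close>.\<close>

lemma DGR_I_arc_orbits:
  assumes P: "perm_group (A, V)"
    and closed: "\<And>g. g \<in> Bij V \<Longrightarrow> preserves_arc_orbits A V g \<Longrightarrow> g \<in> A"
  shows "(A, V) \<in> DGR"
proof -
  define E where "E e = (\<lambda>a. map_prod a a e) ` A" for e
  have "A = aut_digraph V E"
  proof (intro equalityI subsetI)
    fix a assume a: "a \<in> A"
    have aB: "a \<in> Bij V" by (rule perm_group_Bij[OF P a])
    have "E (a x, a y) = E (x, y)" if xy: "x \<in> V" "y \<in> V" for x y
    proof (intro equalityI subsetI)
      fix e assume "e \<in> E (a x, a y)"
      then obtain b where b: "b \<in> A" "e = (b (a x), b (a y))" by (auto simp: E_def)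
      then have "e = map_prod (compose V b a) (compose V b a) (x, y)"
        using xy by (simp add: compose_def)
      then show "e \<in> E (x, y)" unfolding E_def using perm_group_compose[OF P b(1) a] by blast
    next
      fix e assume "e \<in> E (x, y)"
      then obtain b where b: "b \<in> A" "e = (b x, b y)" by (auto simp: E_def)
      let ?c = "compose V b (\<lambda>x\<in>V. inv_into V a x)"
      have "inv_into V a (a z) = z" if "z \<in> V" for z
        using that aB by (auto simp: Bij_def bij_betw_def)
      then have "e = map_prod ?c ?c (a x, a y)"
        using xy b Bij_mem[OF aB] by (simp add: compose_def)
      then show "e \<in> E (a x, a y)"
        unfolding E_def using perm_group_compose[OF P b(1) perm_group_inv[OF P a]] by blast
    qed
    then show "a \<in> aut_digraph V E" using aB by (auto simp: aut_digraph_def)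
  next
    fix g assume g: "g \<in> aut_digraph V E"
    have "preserves_arc_orbits A V g"
      unfolding preserves_arc_orbits_def
    proof (intro ballI impI)
      fix x y assume xy: "x \<in> V" "y \<in> V" "x \<noteq> y"
      have gV: "g x \<in> V" "g y \<in> V" using g xy by (auto simp: aut_digraph_def Bij_mem)
      have "(g x, g y) = map_prod (\<lambda>x\<in>V. x) (\<lambda>x\<in>V. x) (g x, g y)" using gV by simp
      then have "(g x, g y) \<in> E (g x, g y)" using perm_group_id[OF P] unfolding E_def by blast
      then have "(g x, g y) \<in> E (x, y)" using g xy by (simp add: aut_digraph_def)
      then show "\<exists>a\<in>A. g x = a x \<and> g y = a y" by (auto simp: E_def)
    qed
    then show "g \<in> A" using closed g by (simp add: aut_digraph_def)
  qed
  then have "perm_iso (A, V) (aut_digraph V E, V)"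
    by (rule subst[where P = "\<lambda>X. perm_iso (A, V) (X, V)"]) (rule perm_iso_refl)
  then show ?thesis by (rule DGR_I[OF P])
qed

text \<open>The coloring of any realizing digraph is constant on arc orbits, as in the first half of
  \<open>GR_iff\<close>.\<close>

lemma DGR_arc_orbits:
  assumes DGR: "(A, V) \<in> DGR" and g: "g \<in> Bij V" and orb: "preserves_arc_orbits A V g"
  shows "g \<in> A"
proof -
  obtain X :: "'a set" and E :: "'a \<times> 'a \<Rightarrow> 'a \<times> 'a"
    where P: "perm_group (A, V)" and iso: "perm_iso (A, V) (aut_digraph X E, X)"
    using DGR unfolding DGR_def by blast
  have sub: "subgroup A (BijGroup V)" using P by simp
  obtain \<phi> where \<phi>: "bij_betw \<phi> V X"
    and mem: "\<And>g. g \<in> Bij V \<Longrightarrow> g \<in> A \<longleftrightarrow> (\<exists>b\<in>aut_digraph X E. \<forall>v\<in>V. \<phi> (g v) = b (\<phi> v))"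
    by (rule perm_iso_mem[OF sub _ iso]) (auto simp: aut_digraph_def)
  have inj: "\<phi> x \<noteq> \<phi> y" if "x \<in> V" "y \<in> V" "x \<noteq> y" for x y
    using that \<phi> by (auto simp: bij_betw_def inj_on_def)
  have X: "X = \<phi> ` V" using \<phi> by (simp add: bij_betw_def)
  obtain b where b: "b \<in> Bij X" "\<And>v. v \<in> V \<Longrightarrow> b (\<phi> v) = \<phi> (g v)"
    using conj_Bij[OF \<phi> g] by blast
  have "E (\<phi> (g x), \<phi> (g y)) = E (\<phi> x, \<phi> y)" if xy: "x \<in> V" "y \<in> V" "x \<noteq> y" for x y
  proof -
    obtain a where a: "a \<in> A" "g x = a x" "g y = a y"
      using orb xy unfolding preserves_arc_orbits_def by blast
    obtain c where c: "c \<in> aut_digraph X E" "\<forall>v\<in>V. \<phi> (a v) = c (\<phi> v)"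
      using a(1) mem[OF perm_group_Bij[OF P a(1)]] by simp blast
    show ?thesis using c a xy inj[OF xy] by (auto simp: aut_digraph_def X)
  qed
  then have "b \<in> aut_digraph X E" using b by (auto simp: aut_digraph_def X)
  then show ?thesis using mem[OF g] b(2)[symmetric] by blast
qed

text \<open>If \<open>g v\<close> lies outside the orbit of \<open>v\<close>, every other vertex is mapped into the orbit of \<open>v\<close>
  and \<open>g v\<close> lies in the orbit of every other vertex; this forces \<open>V = {v, g v}\<close>.\<close>

lemma edge_orbits_vertex_orbits:
  assumes P: "perm_group (A, V)" and notI2: "(A, V) \<notin> I2"
    and g: "g \<in> Bij V" and orb: "preserves_edge_orbits A V g" and v: "v \<in> V"
  shows "\<exists>a\<in>A. g v = a v"
proof (rule ccontr)
  assume not: "\<not> ?thesis"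
  \<comment> \<open>As \<open>g v\<close> is outside the orbit of \<open>v\<close>, the element
    realizing the image of the edge must match the ends crosswise.\<close>
  have swap: "\<exists>a\<in>A. g v = a u \<and> g u = a v" if "u \<in> V" "u \<noteq> v" for u
    using orb v that not unfolding preserves_edge_orbits_def by (metis doubleton_eq_iff)
  have fixed: "a v = v" if a: "a \<in> A" for a
  proof (rule ccontr)
    assume ne: "a v \<noteq> v"
    have "a v \<in> V" using perm_group_Bij[OF P a] v by (rule Bij_mem)
    then obtain c where "c \<in> A" "g v = c (a v)" using swap ne by blast
    then have "g v = compose V c a v" using v by (simp add: compose_def)
    then show False using not perm_group_compose[OF P \<open>c \<in> A\<close> a] by blast
  qed
  obtain u where u: "u \<in> V" "u \<noteq> v" using P v by auto
  have gu: "g z = v" if "z \<in> V" "z \<noteq> v" for z using swap[OF that] fixed by auto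
  \<comment> \<open>\<open>g\<close> sends every vertex other than \<open>v\<close> to
    \<open>v\<close>, so injectivity allows only one such vertex.\<close>
  have V: "V = {v, u}" using gu u v Bij_eq_iff[OF g] by blast
  have "a = (\<lambda>x\<in>V. x)" if a: "a \<in> A" for a
  proof (rule Bij_eqI)
    show aB: "a \<in> Bij V" by (rule perm_group_Bij[OF P a])
    show "(\<lambda>x\<in>V. x) \<in> Bij V" by (rule perm_group_Bij[OF P perm_group_id[OF P]])
    have "a u \<noteq> v" using Bij_eq_iff[OF aB] fixed[OF a] u v by metis
    then show "a x = (\<lambda>x\<in>V. x) x" if "x \<in> V" for x
      using that Bij_mem[OF aB u(1)] fixed[OF a] V by auto
  qed
  then have "A = {\<lambda>x\<in>V. x}" using perm_group_id[OF P] by blast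
  moreover have "card V = 2" using V u by simp
  ultimately show False using notI2 by (simp add: I2_def BijGroup_def)
qed

section \<open>The wreath product as a permutation group of twists\<close>

text \<open>Normal form of the elements of the wreath product. The index of \<alpha> is the source
  block, and the restriction to \<open>V \<times> W\<close> gives the extensionality that
  \<open>Bij\<close> demands.\<close>

definition twist :: "'v set \<Rightarrow> 'w set \<Rightarrow> ('w \<Rightarrow> 'v \<Rightarrow> 'v) \<Rightarrow> ('w \<Rightarrow> 'w) \<Rightarrow> 'v \<times> 'w \<Rightarrow> 'v \<times> 'w" where
  "twist V W \<alpha> \<beta> = (\<lambda>(v, w)\<in>V \<times> W. (\<alpha> w v, \<beta> w))"

lemma twist_apply [simp]: "v \<in> V \<Longrightarrow> w \<in> W \<Longrightarrow> twist V W \<alpha> \<beta> (v, w) = (\<alpha> w v, \<beta> w)"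
  by (simp add: twist_def)

lemma twist_Bij:
  assumes \<alpha>: "\<And>w. w \<in> W \<Longrightarrow> \<alpha> w \<in> Bij V" and \<beta>: "\<beta> \<in> Bij W"
  shows "twist V W \<alpha> \<beta> \<in> Bij (V \<times> W)"
proof (rule BijI)
  show "twist V W \<alpha> \<beta> \<in> extensional (V \<times> W)" by (simp add: twist_def)
  show "twist V W \<alpha> \<beta> p \<in> V \<times> W" if "p \<in> V \<times> W" for p
    using that Bij_mem[OF \<alpha>] Bij_mem[OF \<beta>] by auto
  show "inj_on (twist V W \<alpha> \<beta>) (V \<times> W)"
    by (rule inj_onI) (auto simp: Bij_eq_iff[OF \<beta>] Bij_eq_iff[OF \<alpha>])
  show "\<exists>p\<in>V \<times> W. q = twist V W \<alpha> \<beta> p" if q: "q \<in> V \<times> W" for q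
  proof -
    obtain v w where vw: "q = (v, w)" "v \<in> V" "w \<in> W" using q by blast
    obtain w' where w': "w' \<in> W" "w = \<beta> w'" using Bij_surj[OF \<beta>] vw by blast
    obtain v' where v': "v' \<in> V" "v = \<alpha> w' v'" using Bij_surj[OF \<alpha>[OF w'(1)] vw(2)] by blast
    have "q = twist V W \<alpha> \<beta> (v', w')" using vw v' w' by simp
    then show ?thesis using v' w' by blast
  qed
qed

text \<open>A twist with components in \<open>A\<close> and \<open>B\<close> is automatically a
  bijection, so elements are parametrized by \<alpha> and \<beta> alone. This replaces
  \<open>wreath.simps\<close>, which leaves the simp set afterwards.\<close>

lemma wreath_eq:
  assumes A: "perm_group (A, V)" and B: "perm_group (B, W)"
  shows "wreath (A, V) (B, W) =
    ({twist V W \<alpha> \<beta> | \<alpha> \<beta>. (\<forall>w\<in>W. \<alpha> w \<in> A) \<and> \<beta> \<in> B}, V \<times> W)"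
proof -
  have tB: "twist V W \<alpha> \<beta> \<in> Bij (V \<times> W)" if "\<forall>w\<in>W. \<alpha> w \<in> A" "\<beta> \<in> B" for \<alpha> \<beta>
    using that perm_group_Bij[OF A] perm_group_Bij[OF B] by (auto intro: twist_Bij)
  have "(\<gamma> \<in> Bij (V \<times> W) \<and>
      (\<exists>\<alpha>. (\<forall>w\<in>W. \<alpha> w \<in> A) \<and> (\<exists>\<beta>\<in>B. \<forall>v\<in>V. \<forall>w\<in>W. \<gamma> (v, w) = (\<alpha> w v, \<beta> w)))) \<longleftrightarrow>
    (\<exists>\<alpha> \<beta>. \<gamma> = twist V W \<alpha> \<beta> \<and> (\<forall>w\<in>W. \<alpha> w \<in> A) \<and> \<beta> \<in> B)" for \<gamma>
  proof
    assume L: "\<gamma> \<in> Bij (V \<times> W) \<and>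
      (\<exists>\<alpha>. (\<forall>w\<in>W. \<alpha> w \<in> A) \<and> (\<exists>\<beta>\<in>B. \<forall>v\<in>V. \<forall>w\<in>W. \<gamma> (v, w) = (\<alpha> w v, \<beta> w)))"
    then obtain \<alpha> \<beta> where ab: "\<forall>w\<in>W. \<alpha> w \<in> A" "\<beta> \<in> B"
      and eq: "\<forall>v\<in>V. \<forall>w\<in>W. \<gamma> (v, w) = (\<alpha> w v, \<beta> w)" by blast
    have "\<gamma> = twist V W \<alpha> \<beta>" by (rule Bij_eqI[OF conjunct1[OF L] tB[OF ab]]) (use eq in auto)
    with ab show "\<exists>\<alpha> \<beta>. \<gamma> = twist V W \<alpha> \<beta> \<and> (\<forall>w\<in>W. \<alpha> w \<in> A) \<and> \<beta> \<in> B" by blast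
  next
    assume "\<exists>\<alpha> \<beta>. \<gamma> = twist V W \<alpha> \<beta> \<and> (\<forall>w\<in>W. \<alpha> w \<in> A) \<and> \<beta> \<in> B"
    then obtain \<alpha> \<beta> where ab: "\<gamma> = twist V W \<alpha> \<beta>" "\<forall>w\<in>W. \<alpha> w \<in> A" "\<beta> \<in> B" by blast
    have "\<forall>v\<in>V. \<forall>w\<in>W. \<gamma> (v, w) = (\<alpha> w v, \<beta> w)" using ab(1) by simp
    then show "\<gamma> \<in> Bij (V \<times> W) \<and>
      (\<exists>\<alpha>. (\<forall>w\<in>W. \<alpha> w \<in> A) \<and> (\<exists>\<beta>\<in>B. \<forall>v\<in>V. \<forall>w\<in>W. \<gamma> (v, w) = (\<alpha> w v, \<beta> w)))"
      using ab(2,3) tB[OF ab(2,3), folded ab(1)] by blast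
  qed
  then show ?thesis unfolding wreath.simps by (simp only:)
qed

declare wreath.simps [simp del]

lemma twist_in_wreathI:
  assumes "perm_group (A, V)" "perm_group (B, W)" "\<forall>w\<in>W. \<alpha> w \<in> A" "\<beta> \<in> B"
  shows "twist V W \<alpha> \<beta> \<in> fst (wreath (A, V) (B, W))"
  unfolding wreath_eq[OF assms(1,2)] fst_conv
  by (intro CollectI exI conjI) (rule refl, use assms(3,4) in auto)

lemma wreathE:
  assumes "perm_group (A, V)" "perm_group (B, W)" "c \<in> fst (wreath (A, V) (B, W))"
  obtains \<alpha> \<beta> where "\<forall>w\<in>W. \<alpha> w \<in> A" "\<beta> \<in> B" "c = twist V W \<alpha> \<beta>"
  using assms(3) unfolding wreath_eq[OF assms(1,2)] by auto

lemma perm_group_wreath: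
  assumes A: "perm_group (A, V)" and B: "perm_group (B, W)"
  shows "perm_group (wreath (A, V) (B, W))"
proof -
  let ?C = "fst (wreath (A, V) (B, W))"
  note CI = twist_in_wreathI[OF A B] and CE = wreathE[OF A B]
  note AB = perm_group_Bij[OF A] note BB = perm_group_Bij[OF B]
  interpret G: group "BijGroup (V \<times> W)" by (rule group_BijGroup)
  have CB: "?C \<subseteq> Bij (V \<times> W)" by (auto elim!: CE intro!: twist_Bij AB BB)
  \<comment> \<open>The outer factor meets block \<open>w\<close> only after it has moved to \<beta>
    \<open>w\<close>, so \<alpha>' is taken there.\<close>
  have mult: "compose (V \<times> W) (twist V W \<alpha>' \<beta>') (twist V W \<alpha> \<beta>) =
      twist V W (\<lambda>w. compose V (\<alpha>' (\<beta> w)) (\<alpha> w)) (compose W \<beta>' \<beta>)"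
    if "\<forall>w\<in>W. \<alpha> w \<in> A" "\<beta> \<in> B" for \<alpha> \<alpha>' \<beta> \<beta>'
    using that by (auto simp: fun_eq_iff twist_def compose_def Bij_mem[OF AB] Bij_mem[OF BB])
  have one: "twist V W (\<lambda>w. \<lambda>v\<in>V. v) (\<lambda>w\<in>W. w) = (\<lambda>p\<in>V \<times> W. p)"
    by (auto simp: fun_eq_iff twist_def)
  have "subgroup ?C (BijGroup (V \<times> W))"
  proof (rule G.subgroupI)
    show "?C \<subseteq> carrier (BijGroup (V \<times> W))" using CB by (simp add: BijGroup_def)
    show "?C \<noteq> {}"
      using CI[of "\<lambda>_. \<lambda>v\<in>V. v", OF _ perm_group_id[OF B]] perm_group_id[OF A] by auto
  next
    fix c assume c: "c \<in> ?C"
    then obtain \<alpha> \<beta> where ab: "\<forall>w\<in>W. \<alpha> w \<in> A" "\<beta> \<in> B" and c_eq: "c = twist V W \<alpha> \<beta>"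
      by (rule CE)
    define \<beta>' where "\<beta>' = (\<lambda>w\<in>W. inv_into W \<beta> w)"
    \<comment> \<open>Block \<open>w\<close> is the image of block \<beta>' \<open>w\<close>, so the
      inverse must undo \<alpha> at that index.\<close>
    define \<alpha>' where "\<alpha>' w = (\<lambda>v\<in>V. inv_into V (\<alpha> (\<beta>' w)) v)" for w
    have \<beta>': "\<beta>' \<in> B" unfolding \<beta>'_def by (rule perm_group_inv[OF B ab(2)])
    have \<alpha>': "\<forall>w\<in>W. \<alpha>' w \<in> A"
      unfolding \<alpha>'_def using perm_group_inv[OF A] ab(1) Bij_mem[OF BB[OF \<beta>']] by blast
    have d: "twist V W \<alpha>' \<beta>' \<in> ?C" by (rule CI[OF \<alpha>' \<beta>'])
    have inv\<beta>: "\<beta>' (\<beta> w) = w" if "w \<in> W" for w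
      using that BB[OF ab(2)] Bij_mem[OF BB[OF ab(2)]] by (auto simp: \<beta>'_def Bij_def bij_betw_def)
    have inv\<alpha>: "\<alpha>' (\<beta> w) (\<alpha> w v) = v" if "w \<in> W" "v \<in> V" for v w
      using that AB[of "\<alpha> w"] ab(1) Bij_mem[OF AB[of "\<alpha> w"]]
      by (auto simp: \<alpha>'_def inv\<beta> Bij_def bij_betw_def)
    have "compose (V \<times> W) (twist V W \<alpha>' \<beta>') c = (\<lambda>p\<in>V \<times> W. p)"
      unfolding c_eq mult[OF ab] one[symmetric]
      by (auto simp: twist_def fun_eq_iff compose_def inv\<alpha> inv\<beta>)
    then have "inv\<^bsub>BijGroup (V \<times> W)\<^esub> c = twist V W \<alpha>' \<beta>'"
      using c d CB by (intro G.inv_equality) (auto simp: BijGroup_def)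
    then show "inv\<^bsub>BijGroup (V \<times> W)\<^esub> c \<in> ?C" using d by simp
  next
    fix c d assume c: "c \<in> ?C" and d: "d \<in> ?C"
    obtain \<alpha>' \<beta>' where ab': "\<forall>w\<in>W. \<alpha>' w \<in> A" "\<beta>' \<in> B" and c_eq: "c = twist V W \<alpha>' \<beta>'"
      using c by (rule CE)
    obtain \<alpha> \<beta> where ab: "\<forall>w\<in>W. \<alpha> w \<in> A" "\<beta> \<in> B" and d_eq: "d = twist V W \<alpha> \<beta>"
      using d by (rule CE)
    have "c \<otimes>\<^bsub>BijGroup (V \<times> W)\<^esub> d = compose (V \<times> W) c d"
      using c d CB by (auto simp: BijGroup_def)
    moreover have "compose (V \<times> W) c d \<in> ?C"
      unfolding c_eq d_eq mult[OF ab]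
      using ab ab' Bij_mem[OF BB[OF ab(2)]]
      by (intro CI ballI perm_group_compose[OF A] perm_group_compose[OF B]) auto
    ultimately show "c \<otimes>\<^bsub>BijGroup (V \<times> W)\<^esub> d \<in> ?C" by simp
  qed
  moreover obtain x y w where "x \<in> V" "y \<in> V" "x \<noteq> y" "w \<in> W" using A B by auto
  then have "\<exists>p\<in>V \<times> W. \<exists>q\<in>V \<times> W. p \<noteq> q" by (intro bexI[of _ "(x, w)"] bexI[of _ "(y, w)"]) auto
  moreover have "wreath (A, V) (B, W) = (?C, V \<times> W)" by (simp add: wreath_eq[OF A B])
  ultimately show ?thesis by (metis perm_group.simps)
qed

text \<open>A twist determines its components: \<alpha> on \<open>W\<close> by first coordinates,
  and \<beta> by the second coordinate at any point of the nonempty set \<open>V\<close>.\<close>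

lemma twist_in_wreath_iff:
  assumes A: "perm_group (A, V)" and B: "perm_group (B, W)"
    and \<alpha>: "\<And>w. w \<in> W \<Longrightarrow> \<alpha> w \<in> Bij V" and \<beta>: "\<beta> \<in> Bij W"
  shows "twist V W \<alpha> \<beta> \<in> fst (wreath (A, V) (B, W)) \<longleftrightarrow> (\<forall>w\<in>W. \<alpha> w \<in> A) \<and> \<beta> \<in> B"
proof
  assume "twist V W \<alpha> \<beta> \<in> fst (wreath (A, V) (B, W))"
  then obtain \<alpha>' \<beta>' where ab: "\<forall>w\<in>W. \<alpha>' w \<in> A" "\<beta>' \<in> B"
    and eq: "twist V W \<alpha> \<beta> = twist V W \<alpha>' \<beta>'" by (rule wreathE[OF A B])
  have eq': "\<alpha> w v = \<alpha>' w v \<and> \<beta> w = \<beta>' w" if "v \<in> V" "w \<in> W" for v w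
    using fun_cong[OF eq, of "(v, w)"] that by simp
  have "\<alpha> w = \<alpha>' w" if "w \<in> W" for w
    by (rule Bij_eqI[OF \<alpha>[OF that] perm_group_Bij[OF A]]) (use that ab eq' in auto)
  moreover have "\<beta> = \<beta>'"
    by (rule Bij_eqI[OF \<beta> perm_group_Bij[OF B ab(2)]]) (use A eq' in auto)
  ultimately show "(\<forall>w\<in>W. \<alpha> w \<in> A) \<and> \<beta> \<in> B" using ab by simp
qed (simp add: twist_in_wreathI[OF A B])

section \<open>Edge orbits of the wreath product\<close>

text \<open>A representative only has to act correctly on the blocks meeting the edge, and its
  components on different blocks are independent. Hence one \<open>a\<close> for an edge inside a
  block, but unrelated \<open>a\<close> and \<open>a'\<close> for an edge between blocks.\<close>

lemma edge_orbits_twist: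
  assumes A: "perm_group (A, V)" and B: "perm_group (B, W)"
    and inner: "\<And>w x y. w \<in> W \<Longrightarrow> x \<in> V \<Longrightarrow> y \<in> V \<Longrightarrow> x \<noteq> y \<Longrightarrow>
      \<exists>a\<in>A. \<exists>b\<in>B. {\<alpha> w x, \<alpha> w y} = {a x, a y} \<and> \<beta> w = b w"
    and outer: "\<And>w w' x y. w \<in> W \<Longrightarrow> w' \<in> W \<Longrightarrow> w \<noteq> w' \<Longrightarrow> x \<in> V \<Longrightarrow> y \<in> V \<Longrightarrow>
      \<exists>a\<in>A. \<exists>a'\<in>A. \<exists>b\<in>B. {(\<alpha> w x, \<beta> w), (\<alpha> w' y, \<beta> w')} = {(a x, b w), (a' y, b w')}"
  shows "preserves_edge_orbits (fst (wreath (A, V) (B, W))) (V \<times> W) (twist V W \<alpha> \<beta>)"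
  unfolding preserves_edge_orbits_def
proof (intro ballI impI)
  fix p q assume pq: "p \<in> V \<times> W" "q \<in> V \<times> W" "p \<noteq> q"
  obtain x w y w' where p: "p = (x, w)" "x \<in> V" "w \<in> W" and q: "q = (y, w')" "y \<in> V" "w' \<in> W"
    using pq by blast
  note mem = twist_in_wreathI[OF A B]
  show "\<exists>c\<in>fst (wreath (A, V) (B, W)).
      {twist V W \<alpha> \<beta> p, twist V W \<alpha> \<beta> q} = {c p, c q}"
  proof (cases "w = w'")
    case True
    then have "x \<noteq> y" using pq p q by simp
    then obtain a b where ab: "a \<in> A" "b \<in> B" "{\<alpha> w x, \<alpha> w y} = {a x, a y}" "\<beta> w = b w"
      using inner p q by blast
    have "{twist V W \<alpha> \<beta> p, twist V W \<alpha> \<beta> q} = {twist V W (\<lambda>_. a) b p, twist V W (\<lambda>_. a) b q}"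
      using p q True ab by (auto simp: doubleton_eq_iff)
    then show ?thesis using mem[of "\<lambda>_. a" b] ab by blast
  next
    case False
    then obtain a a' b where ab: "a \<in> A" "a' \<in> A" "b \<in> B"
      "{(\<alpha> w x, \<beta> w), (\<alpha> w' y, \<beta> w')} = {(a x, b w), (a' y, b w')}"
      using outer p q by blast
    let ?\<alpha> = "\<lambda>u. if u = w then a else a'"
    have "{twist V W \<alpha> \<beta> p, twist V W \<alpha> \<beta> q} = {twist V W ?\<alpha> b p, twist V W ?\<alpha> b q}"
      using p q False ab(4) by simp
    then show ?thesis using mem[of ?\<alpha> b] ab by auto
  qed
qed

lemma edge_orbits_wreathD:
  assumes A: "perm_group (A, V)" and B: "perm_group (B, W)"
    and orb: "preserves_edge_orbits (fst (wreath (A, V) (B, W))) (V \<times> W) g"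
    and "x \<in> V" "w \<in> W" "y \<in> V" "w' \<in> W" "(x, w) \<noteq> (y, w')"
  obtains \<alpha> b where "\<forall>w\<in>W. \<alpha> w \<in> A" "b \<in> B"
    "{g (x, w), g (y, w')} = {(\<alpha> w x, b w), (\<alpha> w' y, b w')}"
proof -
  obtain c where cC: "c \<in> fst (wreath (A, V) (B, W))"
    and c: "{g (x, w), g (y, w')} = {c (x, w), c (y, w')}"
    using orb[unfolded preserves_edge_orbits_def, rule_format, of "(x, w)" "(y, w')"] assms(4-8) by blast
  from cC obtain \<alpha> b where ab: "\<forall>w\<in>W. \<alpha> w \<in> A" "b \<in> B" "c = twist V W \<alpha> b"
    by (rule wreathE[OF A B])
  show ?thesis by (rule that[OF ab(1,2)]) (use c ab(3) assms(4-7) in simp)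
qed

text \<open>Elements of the wreath product permute the blocks \<open>V \<times> {w}\<close>, so edges inside a block and edges
  between blocks lie in different orbits.\<close>

lemma edge_orbits_wreath_is_twist:
  assumes A: "perm_group (A, V)" and B: "perm_group (B, W)"
    and g: "g \<in> Bij (V \<times> W)"
    and orb: "preserves_edge_orbits (fst (wreath (A, V) (B, W))) (V \<times> W) g"
  obtains \<alpha> \<beta> where "\<And>w. w \<in> W \<Longrightarrow> \<alpha> w \<in> Bij V" "\<beta> \<in> Bij W" "g = twist V W \<alpha> \<beta>"
proof -
  have block: "snd (g (x, w)) = snd (g (y, w')) \<longleftrightarrow> w = w'"
    if xy: "x \<in> V" "w \<in> W" "y \<in> V" "w' \<in> W" for x y w w'
  proof (cases "(x, w) = (y, w')")
    case False
    obtain \<alpha> b where b: "b \<in> B"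
      and eq: "{g (x, w), g (y, w')} = {(\<alpha> w x, b w), (\<alpha> w' y, b w')}"
      by (rule edge_orbits_wreathD[OF A B orb xy False])
    \<comment> \<open>Lying in the same block is symmetric in the two ends, so the matching of the
      ends is irrelevant.\<close>
    have "snd (g (x, w)) = snd (g (y, w')) \<longleftrightarrow> b w = b w'" using eq by (auto simp: doubleton_eq_iff)
    then show ?thesis using Bij_eq_iff[OF perm_group_Bij[OF B b]] xy by simp
  qed simp
  obtain v0 where v0: "v0 \<in> V" using A by auto
  define \<beta> where "\<beta> = (\<lambda>w\<in>W. snd (g (v0, w)))"
  define \<alpha> where "\<alpha> w = (\<lambda>v\<in>V. fst (g (v, w)))" for w
  have geq: "g (v, w) = (\<alpha> w v, \<beta> w)" if "v \<in> V" "w \<in> W" for v w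
    using that block[of v w v0 w] v0 by (simp add: \<alpha>_def \<beta>_def prod_eq_iff)
  have mem: "\<alpha> w v \<in> V \<and> \<beta> w \<in> W" if "v \<in> V" "w \<in> W" for v w
    using Bij_mem[OF g, of "(v, w)"] that by (simp add: geq)
  have inj\<beta>: "\<beta> w = \<beta> w' \<longleftrightarrow> w = w'" if "w \<in> W" "w' \<in> W" for w w'
    using block[OF v0 that(1) v0 that(2)] that by (simp add: \<beta>_def)
  have surj: "\<exists>v'\<in>V. \<exists>w'\<in>W. v = \<alpha> w' v' \<and> w = \<beta> w'" if "v \<in> V" "w \<in> W" for v w
    using Bij_surj[OF g, of "(v, w)"] that by (auto simp: geq)
  have \<beta>: "\<beta> \<in> Bij W"
  proof (rule BijI)
    show "\<exists>x\<in>W. y = \<beta> x" if "y \<in> W" for y using surj[OF v0 that] by blast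
  qed (use mem v0 inj\<beta> in \<open>auto simp: \<beta>_def intro: inj_onI\<close>)
  have \<alpha>: "\<alpha> w \<in> Bij V" if w: "w \<in> W" for w
  proof (rule BijI)
    show "\<alpha> w \<in> extensional V" by (simp add: \<alpha>_def)
    show "\<alpha> w x \<in> V" if "x \<in> V" for x using mem that w by blast
    show "inj_on (\<alpha> w) V"
    proof (rule inj_onI)
      fix x y assume xy: "x \<in> V" "y \<in> V" "\<alpha> w x = \<alpha> w y"
      then have "g (x, w) = g (y, w)" using w by (simp add: geq)
      then show "x = y" using Bij_eq_iff[OF g, of "(x, w)" "(y, w)"] xy w by simp
    qed
    \<comment> \<open>The preimage of \<open>(y, \<beta> w)\<close> under \<open>g\<close> must lie
      in block \<open>w\<close>, as \<beta> is injective.\<close>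
    show "\<exists>x\<in>V. y = \<alpha> w x" if "y \<in> V" for y
      using surj[of y "\<beta> w"] inj\<beta> mem that w by metis
  qed
  have "g = twist V W \<alpha> \<beta>"
    by (rule Bij_eqI[OF g twist_Bij[OF \<alpha> \<beta>]]) (auto simp: geq)
  then show ?thesis using that \<alpha> \<beta> by blast
qed

section \<open>Sufficiency of the conditions\<close>

lemma wreath_in_GR:
  assumes A: "perm_group (A, V)" and B: "perm_group (B, W)"
    and A': "(A, V) \<in> GR \<union> I2"
    and B': "(B, W) \<in> GR \<union> I2 \<or> (B, W) \<in> DGR \<and> intransitive (A, V)"
  shows "wreath (A, V) (B, W) \<in> GR"
proof -
  let ?C = "fst (wreath (A, V) (B, W))"
  have "g \<in> ?C" if g: "g \<in> Bij (V \<times> W)" and orb: "preserves_edge_orbits ?C (V \<times> W) g" for g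
  proof -
    obtain \<alpha> \<beta> where \<alpha>: "\<And>w. w \<in> W \<Longrightarrow> \<alpha> w \<in> Bij V" and \<beta>: "\<beta> \<in> Bij W"
      and geq: "g = twist V W \<alpha> \<beta>"
      by (rule edge_orbits_wreath_is_twist[OF A B g orb]) blast
    have cross: "\<exists>a\<in>A. \<exists>a'\<in>A. \<exists>b\<in>B.
        {(\<alpha> w x, \<beta> w), (\<alpha> w' y, \<beta> w')} = {(a x, b w), (a' y, b w')}"
      if xy: "x \<in> V" "y \<in> V" "w \<in> W" "w' \<in> W" "w \<noteq> w'" for x y w w'
    proof -
      obtain \<alpha>' b where ab: "\<forall>w\<in>W. \<alpha>' w \<in> A" "b \<in> B"
        and eq: "{g (x, w), g (y, w')} = {(\<alpha>' w x, b w), (\<alpha>' w' y, b w')}"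
        by (rule edge_orbits_wreathD[OF A B orb, of x w y w']) (use xy in auto)
      show ?thesis
        by (intro bexI[of _ "\<alpha>' w"] bexI[of _ "\<alpha>' w'"] bexI[of _ b])
          (use eq ab xy in \<open>simp_all add: geq\<close>)
    qed
    have inner: "\<exists>a\<in>A. \<exists>b\<in>B. {\<alpha> w x, \<alpha> w y} = {a x, a y} \<and> \<beta> w = b w"
      if xy: "x \<in> V" "y \<in> V" "w \<in> W" "x \<noteq> y" for x y w
    proof -
      obtain \<alpha>' b where ab: "\<forall>w\<in>W. \<alpha>' w \<in> A" "b \<in> B"
        and eq: "{g (x, w), g (y, w)} = {(\<alpha>' w x, b w), (\<alpha>' w y, b w)}"
        by (rule edge_orbits_wreathD[OF A B orb, of x w y w]) (use xy in auto)
      have "{\<alpha> w x, \<alpha> w y} = {\<alpha>' w x, \<alpha>' w y} \<and> \<beta> w = b w"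
        using eq xy by (auto simp: geq doubleton_eq_iff)
      then show ?thesis using ab xy by blast
    qed
    have "\<alpha> w \<in> A" if w: "w \<in> W" for w
    proof (cases "(A, V) \<in> GR")
      case True
      have "preserves_edge_orbits A V (\<alpha> w)" using inner w unfolding preserves_edge_orbits_def by blast
      then show ?thesis using True GR_iff[OF A] \<alpha>[OF w] by blast
    next
      case False
      then have triv: "A = {\<lambda>x\<in>V. x}" using A' by (auto simp: I2_def BijGroup_def)
      obtain w' where w': "w' \<in> W" "w \<noteq> w'" using B by auto
      \<comment> \<open>An edge from \<open>(v, w)\<close> to \<open>(v, w')\<close> has first
        coordinate \<open>v\<close> at both ends, and the trivial \<open>A\<close> keeps it for
        either matching.\<close>
      have "\<alpha> w v = v" if "v \<in> V" for v
        using cross[OF that that w w'] that by (auto simp: triv doubleton_eq_iff)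
      then have "\<alpha> w = (\<lambda>x\<in>V. x)"
        using perm_group_Bij[OF A perm_group_id[OF A]] by (intro Bij_eqI[OF \<alpha>[OF w]]) auto
      then show ?thesis using triv by simp
    qed
    note \<alpha>A = this
    obtain x0 y0 where xy0: "x0 \<in> V" "y0 \<in> V" "x0 \<noteq> y0" using A by auto
    consider "(B, W) \<in> GR" | "(B, W) \<in> I2" | "(B, W) \<in> DGR" "intransitive (A, V)"
      using B' by blast
    then have "\<beta> \<in> B"
    proof cases
      case 1
      have "preserves_edge_orbits B W \<beta>"
        unfolding preserves_edge_orbits_def
      proof (intro ballI impI)
        fix w w' assume "w \<in> W" "w' \<in> W" "w \<noteq> w'"
        from cross[OF xy0(1) xy0(1) this]
        show "\<exists>b\<in>B. {\<beta> w, \<beta> w'} = {b w, b w'}" by (auto simp: doubleton_eq_iff)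
      qed
      then show ?thesis using 1 GR_iff[OF B] \<beta> by blast
    next
      case 2
      then have triv: "B = {\<lambda>x\<in>W. x}" by (auto simp: I2_def BijGroup_def)
      \<comment> \<open>An edge inside block \<open>w\<close> shows that \<beta> \<open>w\<close>
        lies in the \<open>B\<close>-orbit of \<open>w\<close>, a single point here.\<close>
      have "\<beta> w = w" if "w \<in> W" for w using inner[OF xy0(1,2) that xy0(3)] triv that by auto
      then have "\<beta> = (\<lambda>x\<in>W. x)"
        using perm_group_Bij[OF B perm_group_id[OF B]] by (intro Bij_eqI[OF \<beta>]) auto
      then show ?thesis using triv by simp
    next
      case 3
      obtain x y where xy: "x \<in> V" "y \<in> V" "\<forall>a\<in>A. a x \<noteq> y"
        using 3(2) intransitive_iff[OF A] by blast
      \<comment> \<open>The orbits of \<open>x\<close> and \<open>y\<close> are disjoint; otherwise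
        \<open>a\<close> followed by the inverse of \<open>a'\<close> would take \<open>x\<close> to
        \<open>y\<close>.\<close>
      have sep: "a x \<noteq> a' y" if a: "a \<in> A" "a' \<in> A" for a a'
      proof
        assume eq: "a x = a' y"
        let ?c = "compose V (\<lambda>x\<in>V. inv_into V a' x) a"
        have aB: "a \<in> Bij V" "a' \<in> Bij V" using a perm_group_Bij[OF A] by auto
        have "?c x = y"
          using xy eq Bij_mem[OF aB(2) xy(2)] aB(2) by (simp add: compose_def Bij_def bij_betw_def)
        then show False using xy(3) perm_group_compose[OF A perm_group_inv[OF A a(2)] a(1)] by blast
      qed
      have "preserves_arc_orbits B W \<beta>"
        unfolding preserves_arc_orbits_def
      proof (intro ballI impI)
        fix w w' assume w: "w \<in> W" "w' \<in> W" "w \<noteq> w'"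
        obtain a a' b where ab: "a \<in> A" "a' \<in> A" "b \<in> B"
          "{(\<alpha> w x, \<beta> w), (\<alpha> w' y, \<beta> w')} = {(a x, b w), (a' y, b w')}"
          using cross[OF xy(1,2) w] by blast
        \<comment> \<open>A crosswise matching would give \<alpha> \<open>w x = a' y\<close>. Since
          \<alpha> \<open>w\<close> is already known to be in \<open>A\<close>, this contradicts
          \<open>sep\<close>.\<close>
        then have "\<beta> w = b w \<and> \<beta> w' = b w'"
          using sep[OF \<alpha>A[OF w(1)] ab(2)] by (auto simp: doubleton_eq_iff)
        then show "\<exists>b\<in>B. \<beta> w = b w \<and> \<beta> w' = b w'" using ab(3) by blast
      qed
      then show ?thesis using DGR_arc_orbits 3(1) \<beta> by blast
    qed
    then show ?thesis unfolding geq using \<alpha>A by (intro twist_in_wreathI[OF A B]) auto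
  qed
  note closed = this
  have eq: "(?C, V \<times> W) = wreath (A, V) (B, W)" by (simp add: wreath_eq[OF A B])
  have pC: "perm_group (?C, V \<times> W)" using perm_group_wreath[OF A B] by (simp only: eq)
  have "(?C, V \<times> W) \<in> GR" using closed by (simp only: GR_iff[OF pC]) blast
  then show ?thesis by (simp only: eq)
qed

section \<open>Necessity of the conditions\<close>

text \<open>Necessity arguments reduce to exhibiting a twist that preserves edge orbits: its
  components are then forced into \<open>A\<close> and \<open>B\<close>.\<close>

lemma twist_in_wreath:
  assumes A: "perm_group (A, V)" and B: "perm_group (B, W)"
    and GR: "wreath (A, V) (B, W) \<in> GR"
    and \<alpha>: "\<And>w. w \<in> W \<Longrightarrow> \<alpha> w \<in> Bij V" and \<beta>: "\<beta> \<in> Bij W"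
    and orb: "preserves_edge_orbits (fst (wreath (A, V) (B, W))) (V \<times> W) (twist V W \<alpha> \<beta>)"
  shows "(\<forall>w\<in>W. \<alpha> w \<in> A) \<and> \<beta> \<in> B"
proof -
  have eq: "(fst (wreath (A, V) (B, W)), V \<times> W) = wreath (A, V) (B, W)"
    by (simp add: wreath_eq[OF A B])
  have pC: "perm_group (fst (wreath (A, V) (B, W)), V \<times> W)"
    using perm_group_wreath[OF A B] by (simp only: eq)
  have "(fst (wreath (A, V) (B, W)), V \<times> W) \<in> GR"
    using GR by (simp only: eq)
  then have "twist V W \<alpha> \<beta> \<in> fst (wreath (A, V) (B, W))"
    using twist_Bij[OF \<alpha> \<beta>] orb by (simp add: GR_iff[OF pC])
  then show ?thesis using twist_in_wreath_iff[OF A B \<alpha> \<beta>] by simp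
qed

text \<open>The witness acts as \<open>g\<close> on one block and fixes every other block pointwise.\<close>

lemma wreath_GR_base:
  assumes A: "perm_group (A, V)" and B: "perm_group (B, W)"
    and GR: "wreath (A, V) (B, W) \<in> GR"
  shows "(A, V) \<in> GR \<union> I2"
proof (rule ccontr)
  assume not: "(A, V) \<notin> GR \<union> I2"
  then obtain g where g: "g \<in> Bij V" "preserves_edge_orbits A V g" "g \<notin> A" using GR_iff[OF A] by blast
  \<comment> \<open>Needed for the edges that join the block moved by \<open>g\<close> to a block
    left fixed.\<close>
  have vorb: "\<exists>a\<in>A. g v = a v" if "v \<in> V" for v
    using edge_orbits_vertex_orbits[OF A _ g(1,2) that] not by blast
  obtain w0 where w0: "w0 \<in> W" using B by auto
  define \<alpha> where "\<alpha> w = (if w = w0 then g else (\<lambda>x\<in>V. x))" for w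
  define \<beta> where "\<beta> = (\<lambda>w\<in>W. w)"
  have idA: "(\<lambda>x\<in>V. x) \<in> A" by (rule perm_group_id[OF A])
  have \<beta>: "\<beta> \<in> B" unfolding \<beta>_def by (rule perm_group_id[OF B])
  have \<alpha>orb: "\<exists>a\<in>A. \<alpha> w v = a v" if "v \<in> V" for w v
  proof (cases "w = w0")
    case False
    then show ?thesis using that by (intro bexI[OF _ idA]) (simp add: \<alpha>_def)
  qed (simp add: \<alpha>_def vorb[OF that])
  have "preserves_edge_orbits (fst (wreath (A, V) (B, W))) (V \<times> W) (twist V W \<alpha> \<beta>)"
  proof (rule edge_orbits_twist[OF A B])
    fix w x y assume xy: "w \<in> W" "x \<in> V" "y \<in> V" "x \<noteq> y"
    have "\<exists>a\<in>A. {\<alpha> w x, \<alpha> w y} = {a x, a y}"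
    proof (cases "w = w0")
      case True
      then show ?thesis using g(2) xy by (simp add: preserves_edge_orbits_def \<alpha>_def)
    next
      case False
      then show ?thesis by (intro bexI[OF _ idA]) (simp add: \<alpha>_def)
    qed
    then show "\<exists>a\<in>A. \<exists>b\<in>B. {\<alpha> w x, \<alpha> w y} = {a x, a y} \<and> \<beta> w = b w" using \<beta> by blast
  next
    fix w w' x y assume "w \<in> W" "w' \<in> W" "w \<noteq> w'" "x \<in> V" "y \<in> V"
    then obtain a a' where "a \<in> A" "a' \<in> A" "\<alpha> w x = a x" "\<alpha> w' y = a' y" using \<alpha>orb by metis
    then show "\<exists>a\<in>A. \<exists>a'\<in>A. \<exists>b\<in>B.
        {(\<alpha> w x, \<beta> w), (\<alpha> w' y, \<beta> w')} = {(a x, b w), (a' y, b w')}" using \<beta> by metis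
  qed
  note orb = this
  have "\<alpha> w \<in> Bij V" for w using g(1) perm_group_Bij[OF A idA] by (simp add: \<alpha>_def)
  then have "\<forall>w\<in>W. \<alpha> w \<in> A" using twist_in_wreath[OF A B GR _ perm_group_Bij[OF B \<beta>] orb] by simp
  then have "\<alpha> w0 \<in> A" using w0 by simp
  then show False using g(3) by (simp add: \<alpha>_def)
qed

text \<open>The witness permutes the blocks by \<open>g\<close> and is the identity inside them.
  Edges inside a block need only \<open>vorb\<close>; edges between blocks use \<open>orb\<close>,
  where transitivity of \<open>A\<close> makes up for a crosswise matching in
  \<open>W\<close>.\<close>

lemma wreath_GR_top:
  assumes A: "perm_group (A, V)" and B: "perm_group (B, W)"
    and GR: "wreath (A, V) (B, W) \<in> GR"
    and g: "g \<in> Bij W" and vorb: "\<And>w. w \<in> W \<Longrightarrow> \<exists>b\<in>B. g w = b w"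
    and orb: "preserves_arc_orbits B W g \<or> preserves_edge_orbits B W g \<and> \<not> intransitive (A, V)"
  shows "g \<in> B"
proof -
  define \<alpha> where "\<alpha> = (\<lambda>w::'b. \<lambda>x\<in>V. x)"
  have \<alpha>: "\<alpha> w \<in> A" for w unfolding \<alpha>_def by (rule perm_group_id[OF A])
  have "preserves_edge_orbits (fst (wreath (A, V) (B, W))) (V \<times> W) (twist V W \<alpha> g)"
  proof (rule edge_orbits_twist[OF A B])
    fix w x y assume "w \<in> W" "x \<in> V" "y \<in> V" "x \<noteq> y"
    then show "\<exists>a\<in>A. \<exists>b\<in>B. {\<alpha> w x, \<alpha> w y} = {a x, a y} \<and> g w = b w"
      using \<alpha> vorb by blast
  next
    fix w w' x y assume w: "w \<in> W" "w' \<in> W" "w \<noteq> w'" and xy: "x \<in> V" "y \<in> V"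
    have \<alpha>x: "\<alpha> u z = z" if "z \<in> V" for u z using that by (simp add: \<alpha>_def)
    from orb consider b where "b \<in> B" "g w = b w" "g w' = b w'"
      | b where "b \<in> B" "g w = b w'" "g w' = b w" "\<not> intransitive (A, V)"
      using w unfolding preserves_arc_orbits_def preserves_edge_orbits_def by (metis doubleton_eq_iff)
    then show "\<exists>a\<in>A. \<exists>a'\<in>A. \<exists>b\<in>B.
        {(\<alpha> w x, g w), (\<alpha> w' y, g w')} = {(a x, b w), (a' y, b w')}"
    proof cases
      case 1
      then show ?thesis using \<alpha> by metis
    next
      case 2
      \<comment> \<open>As \<open>b\<close> matches the blocks crosswise, the first coordinates must
        be exchanged too; the blocks differ, so \<open>a\<close> and \<open>a'\<close> can be chosen
        separately.\<close>
      obtain a a' where a: "a \<in> A" "a x = y" "a' \<in> A" "a' y = x"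
        using 2(4) intransitive_iff[OF A] xy by blast
      have "{(\<alpha> w x, g w), (\<alpha> w' y, g w')} = {(a x, b w), (a' y, b w')}"
        using 2 a xy by (simp add: \<alpha>x insert_commute)
      then show ?thesis using a 2(1) by blast
    qed
  qed
  then show ?thesis using twist_in_wreath[OF A B GR _ g] \<alpha> perm_group_Bij[OF A] by blast
qed

section \<open>Combination of both directions\<close>

theorem theorem2p9:
  fixes A :: "('v \<Rightarrow> 'v) set" and V :: "'v set"
    and B :: "('w \<Rightarrow> 'w) set" and W :: "'w set"
  assumes "perm_group (A, V)" and "perm_group (B, W)"
  shows "wreath (A, V) (B, W) \<in> GR \<longleftrightarrow>
           (A, V) \<in> GR \<union> I2 \<and>
           ((B, W) \<in> GR \<union> I2 \<or>
            (B, W) \<in> DGR - (GR \<union> I2) \<and> intransitive (A, V))"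
proof
  note A = assms(1) and B = assms(2)
  assume GR: "wreath (A, V) (B, W) \<in> GR"
  note top = wreath_GR_top[OF A B GR]
  have DGR: "(B, W) \<in> DGR"
  proof (rule DGR_I_arc_orbits[OF B])
    fix g assume g: "g \<in> Bij W" and orb: "preserves_arc_orbits B W g"
    \<comment> \<open>Every \<open>w\<close> is an end of some arc because \<open>W\<close> has a
      second point.\<close>
    have "\<exists>b\<in>B. g w = b w" if w: "w \<in> W" for w
    proof -
      obtain w' where "w' \<in> W" "w \<noteq> w'" using B by auto
      then show ?thesis using orb w unfolding preserves_arc_orbits_def by blast
    qed
    then show "g \<in> B" using top[OF g] orb by blast
  qed
  \<comment> \<open>Contrapositively, if \<open>(B, W)\<close> is outside
    \<open>GR \<union> I2\<close>, then \<open>A\<close> is intransitive, which leaves the second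
    alternative.\<close>
  have "(B, W) \<in> GR" if notI2: "(B, W) \<notin> I2" and trans: "\<not> intransitive (A, V)"
    unfolding GR_iff[OF B]
    using top edge_orbits_vertex_orbits[OF B notI2] trans by blast
  then show "(A, V) \<in> GR \<union> I2 \<and>
      ((B, W) \<in> GR \<union> I2 \<or> (B, W) \<in> DGR - (GR \<union> I2) \<and> intransitive (A, V))"
    using wreath_GR_base[OF A B GR] DGR by blast
next
  assume "(A, V) \<in> GR \<union> I2 \<and>
      ((B, W) \<in> GR \<union> I2 \<or> (B, W) \<in> DGR - (GR \<union> I2) \<and> intransitive (A, V))"
  then show "wreath (A, V) (B, W) \<in> GR"
    using wreath_in_GR[OF assms] by blast
qed

end
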